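(* Consider an imprecise probability tree, any situation $s$, any extended real variables $f$ and $g$, and any real numbers $\lambda\geq0$ and $\mu$. Then: 1. $\underline{E}(f|s)\geq\inf\{f(\omega):\omega\in\Gamma(s)\}$; 2. $\underline{E}(f+g|s)\geq\underline{E}(f|s)+\underline{E}(g|s)$; 3. $\underline{E}(\lambda f|s)=\lambda\underline{E}(f|s)$; 4. if $f\leq g$ on $\Gamma(s)$ strictly almost surely (i.e. the event $\{\omega\in\Gamma(s):f(\omega)>g(\omega)\}$ is strictly null), then $\underline{E}(f|s)\leq\underline{E}(g|s)$ and $\overline{E}(f|s)\leq\overline{E}(g|s)$; as a consequence, if $f=g$ on $\Gamma(s)$ strictly almost surely, then $\underline{E}(f|s)=\underline{E}(g|s)$ and $\overline{E}(f|s)=\overline{E}(g|s)$; 5. $\inf\{f(\omega):\omega\in\Gamma(s)\}\leq\underline{E}(f|s)\leq\overline{E}(f|s)\leq\sup\{f(\omega):\omega\in\Gamma(s)\}$; 6. $\underline{E}(f+\mu|s)=\underline{E}(f|s)+\mu$ and $\overline{E}(f+\mu|s)=\overline{E}(f|s)+\mu$.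
   Context: Conventions in the extended reals: $\infty+\infty=\infty$, $-\infty+(-\infty)=-\infty$, $-\infty+\infty=\infty+(-\infty)=-\infty$, $a+\infty=\infty+a=\infty$ and $a+(-\infty)=-\infty+a=-\infty$ for real $a$, and $0\cdot(\pm\infty)=(\pm\infty)\cdot0=0$. Write $\mathbb{N}=\{1,2,\dots\}$ and $\mathbb{N}_0=\mathbb{N}\cup\{0\}$. For each $k\in\mathbb{N}$ let $\mathcal{X}_k$ be a non-empty finite set. A situation is a finite string $x_{1:n}\in\mathcal{X}_{1:n}:=\mathcal{X}_1\times\dots\times\mathcal{X}_n$ with $n\in\mathbb{N}_0$; the empty string is $\square$. A path is an element $\omega=(\omega_1,\omega_2,\dots)$ of $\Omega:=\prod_{k\in\mathbb{N}}\mathcal{X}_k$; $\omega^n:=(\omega_1,\dots,\omega_n)$. For a situation $s=x_{1:n}$, $\Gamma(s):=\{\omega\in\Omega:\omega^n=x_{1:n}\}$. An extended real variable is a map $\Omega\to\mathbb{R}\cup\{-\infty,+\infty\}$. A gamble on a set $Y$ is a bounded function $Y\to\mathbb{R}$; $\mathcal{G}(Y)$ is the set of these. A lower expectation on $\mathcal{G}(Y)$ is a functional $\underline{E}\colon\mathcal{G}(Y)\to\mathbb{R}$ with $\underline{E}(f)\geq\inf f$, $\underline{E}(f+g)\geq\underline{E}(f)+\underline{E}(g)$ and $\underline{E}(\lambda f)=\lambda\underline{E}(f)$ for all gambles $f,g$ and real $\lambda\geq0$; its conjugate is $\overline{E}(f):=-\underline{E}(-f)$. An imprecise probability tree attaches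 to each situation $x_{1:n}$ a lower expectation $\underline{Q}(\cdot|x_{1:n})$ on $\mathcal{G}(\mathcal{X}_{n+1})$, with conjugate $\overline{Q}(\cdot|x_{1:n})$. A real process is a real-valued map $\mathcal{F}$ on situations; $\Delta\mathcal{F}(x_{1:n})(x_{n+1}):=\mathcal{F}(x_{1:n+1})-\mathcal{F}(x_{1:n})$. A submartingale is a real process $\mathcal{M}$ with $\underline{Q}(\Delta\mathcal{M}(s)|s)\geq0$ for all situations $s$; a supermartingale is a real process with $\overline{Q}(\Delta\mathcal{M}(s)|s)\leq0$ for all $s$. A test supermartingale is a non-negative supermartingale $\mathcal{T}$ with $\mathcal{T}(\square)=1$. An event $A\subseteq\Omega$ is strictly null if some test supermartingale $\mathcal{T}$ satisfies $\lim_{n\to\infty}\mathcal{T}(\omega^n)=+\infty$ for all $\omega\in A$. $\limsup\mathcal{M}(\omega):=\limsup_{n\to\infty}\mathcal{M}(\omega^n)$ and similarly for $\liminf$. For an extended real variable $f$ and situation $s$: $$\underline{E}(f|s):=\sup\{\mathcal{M}(s):\mathcal{M}\text{ a bounded above submartingale with }\limsup\mathcal{M}(\omega)\leq f(\omega)\text{ for all }\omega\in\Gamma(s)\},$$ $$\overline{E}(f|s):=\inf\{\mathcal{M}(s):\mathcal{M}\text{ a bounded below supermartingale with }\liminf\mathcal{M}(\omega)\geq f(\omega)\text{ for all }\omega\in\Gamma(s)\}=-\underline{E}(-f|s),$$ with $\sup\emptyset=-\infty$ and $\inf\emptyset=+\infty$. *)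

theory Defs
  imports "HOL-Analysis.Analysis"
begin

text \<open>
  Indices are shifted by one: the state space of time \<open>k + 1\<close> is \<open>X k\<close> and the entry
  \<open>\<omega>\<^sub>k\<^sub>+\<^sub>1\<close> of a path is \<open>\<omega> k\<close>.  In this way a situation \<open>x\<^sub>1, \<dots>, x\<^sub>n\<close> is an ordinary list
  of length \<open>n\<close>, and the state space of its successors is \<open>X n\<close>.  Processes, variables and
  gambles are total functions of which only the values on situations, paths and state spaces
  are ever used.
\<close>

definition situations :: "(nat \<Rightarrow> 'a set) \<Rightarrow> 'a list set" where
  "situations X = {xs. \<forall>i<length xs. xs ! i \<in> X i}"

definition paths :: "(nat \<Rightarrow> 'a set) \<Rightarrow> (nat \<Rightarrow> 'a) set" where
  "paths X = (\<Pi> k\<in>UNIV. X k)"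

definition initial :: "(nat \<Rightarrow> 'a) \<Rightarrow> nat \<Rightarrow> 'a list" where
  "initial \<omega> n = map \<omega> [0..<n]"

definition cylinder :: "(nat \<Rightarrow> 'a set) \<Rightarrow> 'a list \<Rightarrow> (nat \<Rightarrow> 'a) set" where
  "cylinder X s = {\<omega> \<in> paths X. initial \<omega> (length s) = s}"

text \<open>
  The library has \<open>\<infinity> + (-\<infinity>) = \<infinity>\<close> on \<^typ>\<open>ereal\<close>; here \<open>-\<infinity>\<close> absorbs.  The
  library product already satisfies \<open>0 * (\<plusminus>\<infinity>) = 0\<close>.
\<close>

definition ladd :: "ereal \<Rightarrow> ereal \<Rightarrow> ereal" (infixl "+\<^sub>e" 65) where
  "a +\<^sub>e b = (if a = -\<infinity> \<or> b = -\<infinity> then -\<infinity> else a + b)"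

definition gambles :: "'b set \<Rightarrow> ('b \<Rightarrow> real) set" where
  "gambles Y = {f. bounded (f ` Y)}"

text \<open>
  The first clause says that \<open>E\<close> is a functional on gambles on \<open>Y\<close>, i.e. that it does not
  see the values of its argument outside \<open>Y\<close>.
\<close>

definition lower_expectation :: "'b set \<Rightarrow> (('b \<Rightarrow> real) \<Rightarrow> real) \<Rightarrow> bool" where
  "lower_expectation Y E \<longleftrightarrow>
     (\<forall>f\<in>gambles Y. \<forall>g\<in>gambles Y. (\<forall>y\<in>Y. f y = g y) \<longrightarrow> E f = E g) \<and>
     (\<forall>f\<in>gambles Y. E f \<ge> (INF y\<in>Y. f y)) \<and>
     (\<forall>f\<in>gambles Y. \<forall>g\<in>gambles Y. E (\<lambda>y. f y + g y) \<ge> E f + E g) \<and>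
     (\<forall>f\<in>gambles Y. \<forall>c\<ge>0. E (\<lambda>y. c * f y) = c * E f)"

definition conjugate :: "(('b \<Rightarrow> real) \<Rightarrow> real) \<Rightarrow> ('b \<Rightarrow> real) \<Rightarrow> real" where
  "conjugate E f = - E (\<lambda>y. - f y)"

definition imprecise_tree ::
    "(nat \<Rightarrow> 'a set) \<Rightarrow> ('a list \<Rightarrow> ('a \<Rightarrow> real) \<Rightarrow> real) \<Rightarrow> bool" where
  "imprecise_tree X Q \<longleftrightarrow>
     (\<forall>k. finite (X k) \<and> X k \<noteq> {}) \<and>
     (\<forall>s\<in>situations X. lower_expectation (X (length s)) (Q s))"

definition increment :: "('a list \<Rightarrow> real) \<Rightarrow> 'a list \<Rightarrow> 'a \<Rightarrow> real" where
  "increment F s x = F (s @ [x]) - F s"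

definition submartingale ::
    "(nat \<Rightarrow> 'a set) \<Rightarrow> ('a list \<Rightarrow> ('a \<Rightarrow> real) \<Rightarrow> real) \<Rightarrow> ('a list \<Rightarrow> real) \<Rightarrow> bool" where
  "submartingale X Q M \<longleftrightarrow> (\<forall>s\<in>situations X. Q s (increment M s) \<ge> 0)"

definition supermartingale ::
    "(nat \<Rightarrow> 'a set) \<Rightarrow> ('a list \<Rightarrow> ('a \<Rightarrow> real) \<Rightarrow> real) \<Rightarrow> ('a list \<Rightarrow> real) \<Rightarrow> bool" where
  "supermartingale X Q M \<longleftrightarrow> (\<forall>s\<in>situations X. conjugate (Q s) (increment M s) \<le> 0)"

definition test_supermartingale ::
    "(nat \<Rightarrow> 'a set) \<Rightarrow> ('a list \<Rightarrow> ('a \<Rightarrow> real) \<Rightarrow> real) \<Rightarrow> ('a list \<Rightarrow> real) \<Rightarrow> bool" where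
  "test_supermartingale X Q T \<longleftrightarrow>
     supermartingale X Q T \<and> (\<forall>s\<in>situations X. T s \<ge> 0) \<and> T [] = 1"

definition strictly_null ::
    "(nat \<Rightarrow> 'a set) \<Rightarrow> ('a list \<Rightarrow> ('a \<Rightarrow> real) \<Rightarrow> real) \<Rightarrow> (nat \<Rightarrow> 'a) set \<Rightarrow> bool" where
  "strictly_null X Q A \<longleftrightarrow>
     A \<subseteq> paths X \<and>
     (\<exists>T. test_supermartingale X Q T \<and>
          (\<forall>\<omega>\<in>A. filterlim (\<lambda>n. T (initial \<omega> n)) at_top sequentially))"

definition lower_exp ::
    "(nat \<Rightarrow> 'a set) \<Rightarrow> ('a list \<Rightarrow> ('a \<Rightarrow> real) \<Rightarrow> real) \<Rightarrow>
     ((nat \<Rightarrow> 'a) \<Rightarrow> ereal) \<Rightarrow> 'a list \<Rightarrow> ereal" where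
  "lower_exp X Q f s = Sup {ereal (M s) | M.
     submartingale X Q M \<and> bdd_above (M ` situations X) \<and>
     (\<forall>\<omega>\<in>cylinder X s. limsup (\<lambda>n. ereal (M (initial \<omega> n))) \<le> f \<omega>)}"

definition upper_exp ::
    "(nat \<Rightarrow> 'a set) \<Rightarrow> ('a list \<Rightarrow> ('a \<Rightarrow> real) \<Rightarrow> real) \<Rightarrow>
     ((nat \<Rightarrow> 'a) \<Rightarrow> ereal) \<Rightarrow> 'a list \<Rightarrow> ereal" where
  "upper_exp X Q f s = Inf {ereal (M s) | M.
     supermartingale X Q M \<and> bdd_below (M ` situations X) \<and>
     (\<forall>\<omega>\<in>cylinder X s. liminf (\<lambda>n. ereal (M (initial \<omega> n))) \<ge> f \<omega>)}"

end

theory Submission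
  imports Defs
begin

text \<open>
  The lower and upper expectations are conjugate, so everything reduces to lower expectations,
  and there to two ideas.

  First, submartingales form a convex cone containing the constants
  (\<open>submartingale_const\<close>, \<open>submartingale_add\<close>, \<open>submartingale_scale\<close>).  Constants give the
  infimum bound, sums give superadditivity (\<open>lower_exp_superadd\<close>; the limits superior add up
  without an indeterminate form because the submartingales are bounded above), and scaling
  gives homogeneity.  Subtracting \<open>T / (n + 1)\<close> for a test supermartingale \<open>T\<close> that tends to
  infinity on an event changes the value at \<open>s\<close> by as little as desired but pushes the
  submartingale to \<open>-\<infinity>\<close> on that event; this yields the insensitivity to strictly null events
  (\<open>lower_exp_mono_strictly_null\<close>).

  Second, a local lower expectation of an increment is at most its maximum, so from any
  situation a submartingale can be followed along a path on which it never falls below its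
  initial value (\<open>submartingale_nondecreasing_path\<close>).  Hence the lower expectation is at most
  the supremum (\<open>lower_exp_le_SUP\<close>).  Constants therefore have their own value as lower
  expectation, and superadditivity then gives invariance under translation as well as
  \<open>lower_exp f \<le> upper_exp f\<close>, the latter by applying it to \<open>f\<close> and \<open>-f\<close>.
\<close>

section \<open>Local lower expectations\<close>

lemma gambles_finite [simp]: "finite Y \<Longrightarrow> f \<in> gambles Y"
  by (simp add: gambles_def finite_imp_bounded)

lemma lower_expectation_Inf:
  "lower_expectation Y E \<Longrightarrow> finite Y \<Longrightarrow> (INF y\<in>Y. f y) \<le> E f"
  by (simp add: lower_expectation_def)

lemma lower_expectation_superadd:
  "lower_expectation Y E \<Longrightarrow> finite Y \<Longrightarrow> E f + E g \<le> E (\<lambda>y. f y + g y)"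
  by (simp add: lower_expectation_def)

lemma lower_expectation_scale:
  "lower_expectation Y E \<Longrightarrow> finite Y \<Longrightarrow> 0 \<le> c \<Longrightarrow> E (\<lambda>y. c * f y) = c * E f"
  by (simp add: lower_expectation_def)

lemma lower_expectation_zero:
  assumes "lower_expectation Y E" "finite Y"
  shows "E (\<lambda>_. 0) = 0"
  using lower_expectation_scale[OF assms, of 0 "\<lambda>_. 0"] by simp

lemma lower_expectation_nonneg_imp_ex:
  assumes E: "lower_expectation Y E" and Y: "finite Y" "Y \<noteq> {}" and "0 \<le> E f"
  shows "\<exists>y\<in>Y. 0 \<le> f y"
proof (rule ccontr)
  assume "\<not> ?thesis"
  then have neg: "\<And>y. y \<in> Y \<Longrightarrow> 0 < - f y" by force
  have "(INF y\<in>Y. - f y) \<in> (\<lambda>y. - f y) ` Y"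
    using Y by (simp add: cInf_eq_Min)
  then have "0 < (INF y\<in>Y. - f y)" using neg by force
  also have "\<dots> \<le> E (\<lambda>y. - f y)" by (rule lower_expectation_Inf[OF E Y(1)])
  finally have "0 < E f + E (\<lambda>y. - f y)" using \<open>0 \<le> E f\<close> by simp
  also have "\<dots> \<le> E (\<lambda>y. f y + - f y)" by (rule lower_expectation_superadd[OF E Y(1)])
  also have "\<dots> = 0" using lower_expectation_zero[OF E Y(1)] by simp
  finally show False by simp
qed

section \<open>Situations and paths\<close>

lemma length_initial [simp]: "length (initial \<omega> n) = n"
  by (simp add: initial_def)

lemma initial_in_situations: "\<omega> \<in> cylinder X s \<Longrightarrow> initial \<omega> n \<in> situations X"
  by (auto simp: cylinder_def paths_def situations_def initial_def)

lemma situations_snoc: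
  "xs \<in> situations X \<Longrightarrow> x \<in> X (length xs) \<Longrightarrow> xs @ [x] \<in> situations X"
  by (auto simp: situations_def nth_append less_Suc_eq)

lemma imprecise_tree_local:
  assumes "imprecise_tree X Q"
  shows "finite (X k)" "X k \<noteq> {}" "s \<in> situations X \<Longrightarrow> lower_expectation (X (length s)) (Q s)"
  using assms by (auto simp: imprecise_tree_def)

section \<open>Submartingales\<close>

lemma supermartingale_iff_uminus:
  "supermartingale X Q M \<longleftrightarrow> submartingale X Q (\<lambda>t. - M t)"
proof -
  have "increment (\<lambda>t. - M t) s = (\<lambda>y. - increment M s y)" for s
    by (auto simp: increment_def)
  then show ?thesis
    by (simp add: supermartingale_def submartingale_def conjugate_def)
qed

lemma submartingale_const:
  assumes "imprecise_tree X Q"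
  shows "submartingale X Q (\<lambda>_. r)"
proof -
  have "increment (\<lambda>_. r) s = (\<lambda>_. 0)" for s :: "'a list"
    by (auto simp: increment_def)
  then show ?thesis
    by (simp add: submartingale_def
        lower_expectation_zero[OF imprecise_tree_local(3,1)[OF assms]])
qed

lemma submartingale_add:
  assumes X: "imprecise_tree X Q" and "submartingale X Q M" "submartingale X Q N"
  shows "submartingale X Q (\<lambda>t. M t + N t)"
  unfolding submartingale_def
proof
  fix s assume s: "s \<in> situations X"
  have "increment (\<lambda>t. M t + N t) s = (\<lambda>y. increment M s y + increment N s y)"
    by (auto simp: increment_def)
  moreover have "0 \<le> Q s (increment M s) + Q s (increment N s)"
    using assms(2,3) s by (simp add: submartingale_def)
  ultimately show "0 \<le> Q s (increment (\<lambda>t. M t + N t) s)"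
    using lower_expectation_superadd[OF imprecise_tree_local(3)[OF X s] imprecise_tree_local(1)[OF X],
      of "increment M s" "increment N s"] by simp
qed

lemma submartingale_scale:
  assumes X: "imprecise_tree X Q" and "submartingale X Q M" "0 \<le> c"
  shows "submartingale X Q (\<lambda>t. c * M t)"
  unfolding submartingale_def
proof
  fix s assume s: "s \<in> situations X"
  have "increment (\<lambda>t. c * M t) s = (\<lambda>y. c * increment M s y)"
    by (auto simp: increment_def algebra_simps)
  then show "0 \<le> Q s (increment (\<lambda>t. c * M t) s)"
    using lower_expectation_scale[OF imprecise_tree_local(3)[OF X s] imprecise_tree_local(1)[OF X],
      of c "increment M s"] assms s by (simp add: submartingale_def)
qed

text \<open>
  Since the local lower expectation of an increment is at most its maximum, every situation
  has a successor at which the submartingale is at least as large; a path is obtained by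
  moving to such a successor over and over again.
\<close>

lemma submartingale_nondecreasing_path:
  assumes X: "imprecise_tree X Q" and M: "submartingale X Q M" and s: "s \<in> situations X"
  obtains \<omega> where "\<omega> \<in> cylinder X s" "\<And>n. length s \<le> n \<Longrightarrow> M s \<le> M (initial \<omega> n)"
proof -
  let ?P = "\<lambda>n t. t \<in> situations X \<and> length t = length s + n \<and> M s \<le> M t \<and> (n = 0 \<longrightarrow> t = s)"
  have "\<exists>h. \<forall>n. ?P n (h n) \<and> (\<exists>x. h (Suc n) = h n @ [x])"
  proof (rule dependent_nat_choice)
    show "\<exists>t. ?P 0 t" using s by auto
  next
    fix t n assume t: "?P n t"
    have "0 \<le> Q t (increment M t)" using M t by (simp add: submartingale_def)
    then obtain x where "x \<in> X (length t)" "0 \<le> increment M t x"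
      using lower_expectation_nonneg_imp_ex[OF imprecise_tree_local(3)[OF X] imprecise_tree_local(1,2)[OF X]] t
      by blast
    then show "\<exists>t'. ?P (Suc n) t' \<and> (\<exists>x. t' = t @ [x])"
      using t by (intro exI[of _ "t @ [x]"]) (auto simp: situations_snoc increment_def)
  qed
  then obtain h where h: "\<And>n. ?P n (h n)" and step: "\<And>n. \<exists>x. h (Suc n) = h n @ [x]"
    by blast
  \<comment> \<open>The list \<open>h (Suc k)\<close> has length \<open>length s + Suc k > k\<close>, so this entry exists.\<close>
  define \<omega> where "\<omega> k = h (Suc k) ! k" for k
  have ext: "h (m + d) ! i = h m ! i" if "i < length (h m)" for m d i
  proof (induction d)
    case (Suc d)
    have "i < length (h (m + d))" using that h[of m] h[of "m + d"] by simp
    then show ?case using Suc step[of "m + d"] by (auto simp: nth_append)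
  qed simp
  have nth: "h n ! i = \<omega> i" if "i < length (h n)" for n i
  proof -
    have "i < length (h (Suc i))" using h[of "Suc i"] by simp
    then have "h (Suc i + n) ! i = \<omega> i" using ext[of i "Suc i" n] by (simp add: \<omega>_def)
    moreover have "h (n + Suc i) ! i = h n ! i" by (rule ext[OF that])
    ultimately show ?thesis by (simp add: add.commute)
  qed
  have ini: "initial \<omega> (length s + n) = h n" for n
    using h[of n] nth[of _ n] by (auto intro!: nth_equalityI simp: initial_def)
  show ?thesis
  proof
    have "\<omega> k \<in> X k" for k
      using h[of "Suc k"] by (auto simp: \<omega>_def situations_def)
    then show "\<omega> \<in> cylinder X s"
      using ini[of 0] h[of 0] by (auto simp: cylinder_def paths_def)
    show "M s \<le> M (initial \<omega> n)" if "length s \<le> n" for n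
      using ini[of "n - length s"] h[of "n - length s"] that by simp
  qed
qed

lemma cylinder_nonempty:
  assumes "imprecise_tree X Q" "s \<in> situations X"
  shows "cylinder X s \<noteq> {}"
  using submartingale_nondecreasing_path[OF assms(1) submartingale_const[OF assms(1)] assms(2)]
  by blast

lemma limsup_bdd_above_process:
  assumes "bdd_above (M ` situations X)" "\<omega> \<in> cylinder X s"
  shows "limsup (\<lambda>n. ereal (M (initial \<omega> n))) < \<infinity>"
proof -
  obtain B where "\<And>t. t \<in> situations X \<Longrightarrow> M t \<le> B"
    using assms(1) by (auto simp: bdd_above_def)
  then have "limsup (\<lambda>n. ereal (M (initial \<omega> n))) \<le> ereal B"
    using initial_in_situations[OF assms(2)] by (intro Limsup_bounded) simp
  also have "\<dots> < \<infinity>" by simp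
  finally show ?thesis .
qed

section \<open>Lower expectations\<close>

lemma lower_exp_upper:
  assumes "submartingale X Q M" "bdd_above (M ` situations X)"
    "\<And>\<omega>. \<omega> \<in> cylinder X s \<Longrightarrow> limsup (\<lambda>n. ereal (M (initial \<omega> n))) \<le> f \<omega>"
  shows "ereal (M s) \<le> lower_exp X Q f s"
  unfolding lower_exp_def using assms by (intro Sup_upper) auto

lemma lower_exp_least:
  assumes "\<And>M. submartingale X Q M \<Longrightarrow> bdd_above (M ` situations X) \<Longrightarrow>
    (\<And>\<omega>. \<omega> \<in> cylinder X s \<Longrightarrow> limsup (\<lambda>n. ereal (M (initial \<omega> n))) \<le> f \<omega>) \<Longrightarrow>
    ereal (M s) \<le> b"
  shows "lower_exp X Q f s \<le> b"
  unfolding lower_exp_def using assms by (intro Sup_least) auto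

lemma lower_exp_mono:
  assumes "\<And>\<omega>. \<omega> \<in> cylinder X s \<Longrightarrow> f \<omega> \<le> g \<omega>"
  shows "lower_exp X Q f s \<le> lower_exp X Q g s"
  using assms by (intro lower_exp_least lower_exp_upper) (auto intro: order_trans)

text \<open>Conjugacy: negation turns the admissible submartingales into the admissible
  supermartingales for the negated variable.\<close>

lemma upper_exp_eq_uminus:
  "upper_exp X Q f s = - lower_exp X Q (\<lambda>\<omega>. - f \<omega>) s"
proof -
  let ?S = "{ereal (M s) | M. submartingale X Q M \<and> bdd_above (M ` situations X) \<and>
     (\<forall>\<omega>\<in>cylinder X s. limsup (\<lambda>n. ereal (M (initial \<omega> n))) \<le> - f \<omega>)}"
  let ?I = "{ereal (M s) | M. supermartingale X Q M \<and> bdd_below (M ` situations X) \<and>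
     (\<forall>\<omega>\<in>cylinder X s. liminf (\<lambda>n. ereal (M (initial \<omega> n))) \<ge> f \<omega>)}"
  have conv: "(supermartingale X Q (\<lambda>t. - M t) \<and> bdd_below ((\<lambda>t. - M t) ` situations X) \<and>
     (\<forall>\<omega>\<in>cylinder X s. liminf (\<lambda>n. ereal (- M (initial \<omega> n))) \<ge> f \<omega>)) \<longleftrightarrow>
     (submartingale X Q M \<and> bdd_above (M ` situations X) \<and>
     (\<forall>\<omega>\<in>cylinder X s. limsup (\<lambda>n. ereal (M (initial \<omega> n))) \<le> - f \<omega>))" for M
  proof -
    have "liminf (\<lambda>n. ereal (- M (initial \<omega> n))) = - limsup (\<lambda>n. ereal (M (initial \<omega> n)))" for \<omega>
      using ereal_Liminf_uminus[of sequentially "\<lambda>n. ereal (M (initial \<omega> n))"] by simp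
    moreover have "a \<le> - b \<longleftrightarrow> b \<le> - a" for a b :: ereal
      by (metis ereal_minus_le_minus ereal_uminus_uminus)
    ultimately show ?thesis
      using bdd_below_uminus[of "M ` situations X"]
      by (simp add: supermartingale_iff_uminus image_image)
  qed
  have "?I = uminus ` ?S"
  proof (intro equalityI subsetI)
    fix x assume "x \<in> ?I"
    then obtain M where x: "x = - ereal ((\<lambda>t. - M t) s)"
      and M: "supermartingale X Q M" "bdd_below (M ` situations X)"
        "\<forall>\<omega>\<in>cylinder X s. liminf (\<lambda>n. ereal (M (initial \<omega> n))) \<ge> f \<omega>"
      by auto
    then have "ereal ((\<lambda>t. - M t) s) \<in> ?S" using conv[of "\<lambda>t. - M t"] by auto
    then show "x \<in> uminus ` ?S" unfolding x by (rule imageI)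
  next
    fix x assume "x \<in> uminus ` ?S"
    then obtain M where x: "x = ereal ((\<lambda>t. - M t) s)"
      and M: "submartingale X Q M" "bdd_above (M ` situations X)"
        "\<forall>\<omega>\<in>cylinder X s. limsup (\<lambda>n. ereal (M (initial \<omega> n))) \<le> - f \<omega>"
      by auto
    then have "supermartingale X Q (\<lambda>t. - M t) \<and> bdd_below ((\<lambda>t. - M t) ` situations X) \<and>
        (\<forall>\<omega>\<in>cylinder X s. liminf (\<lambda>n. ereal (- M (initial \<omega> n))) \<ge> f \<omega>)"
      by (simp only: conv)
    with x show "x \<in> ?I"
      unfolding mem_Collect_eq by (intro exI[of _ "\<lambda>t. - M t"] conjI) auto
  qed
  then show ?thesis
    by (simp only: upper_exp_def lower_exp_def ereal_Inf_uminus_image_eq)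
qed

lemma INF_le_lower_exp:
  assumes X: "imprecise_tree X Q"
  shows "(INF \<omega>\<in>cylinder X s. f \<omega>) \<le> lower_exp X Q f s"
proof -
  let ?I = "INF \<omega>\<in>cylinder X s. f \<omega>"
  have const: "ereal r \<le> lower_exp X Q f s" if "ereal r \<le> ?I" for r
    using that by (intro lower_exp_upper[where M = "\<lambda>_. r"] submartingale_const[OF X])
      (auto simp: Limsup_const le_INF_iff)
  show ?thesis
  proof (rule dense_le)
    fix y assume "y < ?I"
    \<comment> \<open>The infimum may be infinite, and constant submartingales are real.\<close>
    then obtain r where "y < ereal r" "ereal r < ?I" using ereal_dense2 by blast
    then show "y \<le> lower_exp X Q f s"
      using const[of r] by (meson less_imp_le order_trans)
  qed
qed

lemma lower_exp_le_SUP: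
  assumes X: "imprecise_tree X Q" and s: "s \<in> situations X"
  shows "lower_exp X Q f s \<le> (SUP \<omega>\<in>cylinder X s. f \<omega>)"
proof (rule lower_exp_least)
  fix M assume M: "submartingale X Q M"
    and lim: "\<And>\<omega>. \<omega> \<in> cylinder X s \<Longrightarrow> limsup (\<lambda>n. ereal (M (initial \<omega> n))) \<le> f \<omega>"
  obtain \<omega> where \<omega>: "\<omega> \<in> cylinder X s" "\<And>n. length s \<le> n \<Longrightarrow> M s \<le> M (initial \<omega> n)"
    using submartingale_nondecreasing_path[OF X M s] by blast
  have "ereal (M s) \<le> liminf (\<lambda>n. ereal (M (initial \<omega> n)))"
    using \<omega>(2) by (intro Liminf_bounded) (auto simp: eventually_sequentially)
  also have "\<dots> \<le> limsup (\<lambda>n. ereal (M (initial \<omega> n)))"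
    by (simp add: Liminf_le_Limsup)
  also have "\<dots> \<le> (SUP \<omega>\<in>cylinder X s. f \<omega>)"
    using lim[OF \<omega>(1)] \<omega>(1) by (rule SUP_upper2[rotated])
  finally show "ereal (M s) \<le> (SUP \<omega>\<in>cylinder X s. f \<omega>)" .
qed

lemma lower_exp_const:
  assumes "imprecise_tree X Q" "s \<in> situations X"
  shows "lower_exp X Q (\<lambda>_. a) s = a"
  using INF_le_lower_exp[OF assms(1), where f = "\<lambda>_. a" and s = s] lower_exp_le_SUP[OF assms, of "\<lambda>_. a"]
    cylinder_nonempty[OF assms] by simp

text \<open>
  With the library sum, for which \<open>\<infinity> + (-\<infinity>) = \<infinity>\<close>, the left-hand side could be \<open>\<infinity>\<close> although
  one of the two sets of submartingales is empty.
\<close>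

lemma lower_exp_superadd:
  assumes X: "imprecise_tree X Q"
  shows "lower_exp X Q f s +\<^sub>e lower_exp X Q g s \<le> lower_exp X Q (\<lambda>\<omega>. f \<omega> +\<^sub>e g \<omega>) s"
    (is "_ \<le> ?L")
proof (cases "lower_exp X Q f s = -\<infinity> \<or> lower_exp X Q g s = -\<infinity>")
  case False
  have *: "ereal (M s) + ereal (N s) \<le> ?L"
    if M: "submartingale X Q M" "bdd_above (M ` situations X)"
      "\<And>\<omega>. \<omega> \<in> cylinder X s \<Longrightarrow> limsup (\<lambda>n. ereal (M (initial \<omega> n))) \<le> f \<omega>"
    and N: "submartingale X Q N" "bdd_above (N ` situations X)"
      "\<And>\<omega>. \<omega> \<in> cylinder X s \<Longrightarrow> limsup (\<lambda>n. ereal (N (initial \<omega> n))) \<le> g \<omega>"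
    for M N
  proof -
    have "ereal ((\<lambda>t. M t + N t) s) \<le> ?L"
    proof (rule lower_exp_upper)
      show "submartingale X Q (\<lambda>t. M t + N t)" by (rule submartingale_add[OF X M(1) N(1)])
      obtain A B where "\<And>t. t \<in> situations X \<Longrightarrow> M t \<le> A" "\<And>t. t \<in> situations X \<Longrightarrow> N t \<le> B"
        using M(2) N(2) by (auto simp: bdd_above_def)
      then show "bdd_above ((\<lambda>t. M t + N t) ` situations X)"
        by (intro bdd_aboveI2[of _ _ "A + B"] add_mono)
      fix \<omega> assume \<omega>: "\<omega> \<in> cylinder X s"
      have "limsup (\<lambda>n. ereal (M (initial \<omega> n) + N (initial \<omega> n)))
          \<le> limsup (\<lambda>n. ereal (M (initial \<omega> n))) + limsup (\<lambda>n. ereal (N (initial \<omega> n)))"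
        using ereal_limsup_add_mono[of "\<lambda>n. ereal (M (initial \<omega> n))" "\<lambda>n. ereal (N (initial \<omega> n))"]
        by simp
      \<comment> \<open>Where \<open>f\<close> or \<open>g\<close> is \<open>-\<infinity>\<close>, so is one limit superior, and their sum is \<open>-\<infinity>\<close> only
          because neither of them is \<open>\<infinity>\<close>.\<close>
      also have "\<dots> \<le> f \<omega> +\<^sub>e g \<omega>"
        using M(3)[OF \<omega>] N(3)[OF \<omega>] limsup_bdd_above_process[OF M(2) \<omega>]
          limsup_bdd_above_process[OF N(2) \<omega>]
        by (auto simp: ladd_def intro: add_mono)
      finally show "limsup (\<lambda>n. ereal (M (initial \<omega> n) + N (initial \<omega> n))) \<le> f \<omega> +\<^sub>e g \<omega>" .
    qed
    then show ?thesis by simp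
  qed
  have **: "ereal (M s) + lower_exp X Q g s \<le> ?L"
    if M: "submartingale X Q M" "bdd_above (M ` situations X)"
      "\<And>\<omega>. \<omega> \<in> cylinder X s \<Longrightarrow> limsup (\<lambda>n. ereal (M (initial \<omega> n))) \<le> f \<omega>" for M
  proof -
    have "lower_exp X Q g s \<le> ?L - ereal (M s)"
      by (rule lower_exp_least) (use *[OF M] in \<open>simp add: ereal_le_minus add.commute\<close>)
    then show ?thesis by (simp add: ereal_le_minus add.commute)
  qed
  have "lower_exp X Q f s + lower_exp X Q g s \<le> ?L"
  proof (cases "lower_exp X Q g s")
    case (real r)
    have "lower_exp X Q f s \<le> ?L - ereal r"
      by (rule lower_exp_least) (use ** real in \<open>simp add: ereal_le_minus\<close>)
    then show ?thesis using real by (simp add: ereal_le_minus)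
  next
    case PInf
    have "?L = \<infinity>"
    proof (rule ccontr)
      assume "?L \<noteq> \<infinity>"
      then have "lower_exp X Q f s \<le> -\<infinity>"
        by (intro lower_exp_least) (use ** PInf in force)
      then show False using False by simp
    qed
    then show ?thesis by simp
  qed (use False in simp)
  then show ?thesis using False by (simp add: ladd_def)
qed (auto simp: ladd_def)

lemma lower_exp_scale_ge:
  assumes X: "imprecise_tree X Q" and c: "0 < c"
  shows "ereal c * lower_exp X Q f s \<le> lower_exp X Q (\<lambda>\<omega>. ereal c * f \<omega>) s"
proof -
  have "lower_exp X Q f s \<le> lower_exp X Q (\<lambda>\<omega>. ereal c * f \<omega>) s / ereal c"
  proof (rule lower_exp_least)
    fix M assume M: "submartingale X Q M" "bdd_above (M ` situations X)"
      "\<And>\<omega>. \<omega> \<in> cylinder X s \<Longrightarrow> limsup (\<lambda>n. ereal (M (initial \<omega> n))) \<le> f \<omega>"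
    have "ereal ((\<lambda>t. c * M t) s) \<le> lower_exp X Q (\<lambda>\<omega>. ereal c * f \<omega>) s"
    proof (rule lower_exp_upper)
      show "submartingale X Q (\<lambda>t. c * M t)" using submartingale_scale[OF X M(1)] c by simp
      obtain A where "\<And>t. t \<in> situations X \<Longrightarrow> M t \<le> A"
        using M(2) by (auto simp: bdd_above_def)
      then show "bdd_above ((\<lambda>t. c * M t) ` situations X)"
        using c by (intro bdd_aboveI2[of _ _ "c * A"] mult_left_mono) auto
      fix \<omega> assume "\<omega> \<in> cylinder X s"
      then show "limsup (\<lambda>n. ereal (c * M (initial \<omega> n))) \<le> ereal c * f \<omega>"
        using Limsup_ereal_mult_left[of sequentially c "\<lambda>n. ereal (M (initial \<omega> n))"] c M(3)
        by (auto intro!: ereal_mult_left_mono)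
    qed
    then show "ereal (M s) \<le> lower_exp X Q (\<lambda>\<omega>. ereal c * f \<omega>) s / ereal c"
      using c by (simp add: ereal_le_divide_pos)
  qed
  then show ?thesis using c by (simp add: ereal_le_divide_pos)
qed

lemma lower_exp_scale:
  assumes X: "imprecise_tree X Q" and s: "s \<in> situations X" and c: "0 \<le> c"
  shows "lower_exp X Q (\<lambda>\<omega>. ereal c * f \<omega>) s = ereal c * lower_exp X Q f s"
proof (cases "c = 0")
  case True
  then show ?thesis using lower_exp_const[OF X s, of 0] by (simp flip: zero_ereal_def)
next
  case False
  with c have c: "0 < c" by simp
  have cancel: "ereal (1 / c) * (ereal c * a) = a" for a
    using c by (simp flip: mult.assoc one_ereal_def)
  have "ereal (1 / c) * lower_exp X Q (\<lambda>\<omega>. ereal c * f \<omega>) s \<le> lower_exp X Q f s"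
    using lower_exp_scale_ge[OF X, of "1 / c" "\<lambda>\<omega>. ereal c * f \<omega>"] c by (simp only: cancel) simp
  then have "ereal c * (ereal (1 / c) * lower_exp X Q (\<lambda>\<omega>. ereal c * f \<omega>) s)
      \<le> ereal c * lower_exp X Q f s"
    using c by (intro ereal_mult_left_mono) auto
  then have "lower_exp X Q (\<lambda>\<omega>. ereal c * f \<omega>) s \<le> ereal c * lower_exp X Q f s"
    using c by (simp flip: mult.assoc one_ereal_def)
  then show ?thesis using lower_exp_scale_ge[OF X c] by (intro antisym)
qed

text \<open>
  Superadditivity applied to \<open>f\<close> and the constant \<open>r\<close> gives one inequality; applied to
  \<open>f + r\<close> and the constant \<open>-r\<close> it gives the other one.
\<close>

lemma lower_exp_translate:
  assumes X: "imprecise_tree X Q" and s: "s \<in> situations X"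
  shows "lower_exp X Q (\<lambda>\<omega>. f \<omega> +\<^sub>e ereal r) s = lower_exp X Q f s +\<^sub>e ereal r"
proof (rule antisym)
  show "lower_exp X Q f s +\<^sub>e ereal r \<le> lower_exp X Q (\<lambda>\<omega>. f \<omega> +\<^sub>e ereal r) s"
    using lower_exp_superadd[OF X, of f s "\<lambda>_. ereal r"] lower_exp_const[OF X s] by simp
  have "(a +\<^sub>e ereal r) +\<^sub>e ereal (- r) = a" for a
    by (cases a) (auto simp: ladd_def)
  then have "lower_exp X Q (\<lambda>\<omega>. f \<omega> +\<^sub>e ereal r) s +\<^sub>e ereal (- r) \<le> lower_exp X Q f s"
    using lower_exp_superadd[OF X, of "\<lambda>\<omega>. f \<omega> +\<^sub>e ereal r" s "\<lambda>_. ereal (- r)"]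
      lower_exp_const[OF X s] by simp
  then show "lower_exp X Q (\<lambda>\<omega>. f \<omega> +\<^sub>e ereal r) s \<le> lower_exp X Q f s +\<^sub>e ereal r"
    by (cases "lower_exp X Q (\<lambda>\<omega>. f \<omega> +\<^sub>e ereal r) s"; cases "lower_exp X Q f s")
      (auto simp: ladd_def)
qed

lemma strictly_null_subset: "strictly_null X Q B \<Longrightarrow> A \<subseteq> B \<Longrightarrow> strictly_null X Q A"
  unfolding strictly_null_def by blast

text \<open>
  Subtracting a small multiple of a test supermartingale \<open>T\<close> keeps a submartingale bounded
  above, because \<open>T\<close> is non-negative, and makes it converge to \<open>-\<infinity>\<close> wherever \<open>T\<close> tends to
  infinity, whatever the variable may be there.
\<close>

lemma lower_exp_mono_strictly_null:
  assumes X: "imprecise_tree X Q"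
    and null: "strictly_null X Q {\<omega> \<in> cylinder X s. f \<omega> > g \<omega>}"
  shows "lower_exp X Q f s \<le> lower_exp X Q g s"
proof (rule lower_exp_least)
  fix M assume M: "submartingale X Q M" "bdd_above (M ` situations X)"
    "\<And>\<omega>. \<omega> \<in> cylinder X s \<Longrightarrow> limsup (\<lambda>n. ereal (M (initial \<omega> n))) \<le> f \<omega>"
  obtain T where T: "submartingale X Q (\<lambda>t. - T t)" "\<And>t. t \<in> situations X \<Longrightarrow> 0 \<le> T t"
    and lim: "\<And>\<omega>. \<omega> \<in> cylinder X s \<Longrightarrow> f \<omega> > g \<omega> \<Longrightarrow>
      filterlim (\<lambda>n. T (initial \<omega> n)) at_top sequentially"
    using null unfolding strictly_null_def test_supermartingale_def supermartingale_iff_uminus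
    by blast
  have *: "ereal (M s - T s / real (Suc k)) \<le> lower_exp X Q g s" for k
  proof -
    define e where "e = 1 / real (Suc k)"
    have e: "0 < e" by (simp add: e_def)
    have "ereal ((\<lambda>t. M t + e * - T t) s) \<le> lower_exp X Q g s"
    proof (rule lower_exp_upper)
      show "submartingale X Q (\<lambda>t. M t + e * - T t)"
        using e by (intro submartingale_add submartingale_scale X M(1) T(1)) simp
      obtain A where A: "\<And>t. t \<in> situations X \<Longrightarrow> M t \<le> A"
        using M(2) by (auto simp: bdd_above_def)
      have "M t + e * - T t \<le> A" if "t \<in> situations X" for t
      proof -
        have "M t \<le> A" by (rule A[OF that])
        moreover have "0 \<le> e * T t" using e T(2)[OF that] by simp
        ultimately show ?thesis by simp
      qed
      then show "bdd_above ((\<lambda>t. M t + e * - T t) ` situations X)"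
        by (rule bdd_aboveI2)
      fix \<omega> assume \<omega>: "\<omega> \<in> cylinder X s"
      let ?l = "limsup (\<lambda>n. ereal (e * - T (initial \<omega> n)))"
      have "limsup (\<lambda>n. ereal (M (initial \<omega> n) + e * - T (initial \<omega> n)))
          \<le> limsup (\<lambda>n. ereal (M (initial \<omega> n))) + ?l"
        using ereal_limsup_add_mono[of "\<lambda>n. ereal (M (initial \<omega> n))"
            "\<lambda>n. ereal (e * - T (initial \<omega> n))"] by simp
      also have "\<dots> \<le> g \<omega>"
      proof (cases "f \<omega> > g \<omega>")
        case True
        have "filterlim (\<lambda>n. e * T (initial \<omega> n)) at_top sequentially"
          by (rule filterlim_tendsto_pos_mult_at_top[OF tendsto_const e lim[OF \<omega> True]])
        then have "filterlim (\<lambda>n. e * - T (initial \<omega> n)) at_bot sequentially"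
          by (simp add: filterlim_uminus_at_bot)
        then have "(\<lambda>n. ereal (e * - T (initial \<omega> n))) \<longlonglongrightarrow> -\<infinity>"
          by (auto simp: tendsto_MInfty filterlim_at_bot_dense)
        then have "?l = -\<infinity>" by (rule lim_imp_Limsup[rotated]) simp
        then show ?thesis using limsup_bdd_above_process[OF M(2) \<omega>]
          by (cases "limsup (\<lambda>n. ereal (M (initial \<omega> n)))") auto
      next
        case False
        have "?l \<le> 0"
          using e T(2)[OF initial_in_situations[OF \<omega>]] by (intro Limsup_bounded) simp
        then show ?thesis using M(3)[OF \<omega>] False add_mono[of _ "f \<omega>" ?l 0] by force
      qed
      finally show "limsup (\<lambda>n. ereal (M (initial \<omega> n) + e * - T (initial \<omega> n))) \<le> g \<omega>" .
    qed
    then show ?thesis by (simp add: e_def)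
  qed
  have "(\<lambda>k. M s - T s / real (Suc k)) \<longlonglongrightarrow> M s - 0"
    by (intro tendsto_intros LIMSEQ_Suc lim_const_over_n)
  then have "(\<lambda>k. ereal (M s - T s / real (Suc k))) \<longlonglongrightarrow> ereal (M s)"
    by (intro tendsto_ereal) simp
  then show "ereal (M s) \<le> lower_exp X Q g s"
    by (rule LIMSEQ_le_const2) (use * in blast)
qed

section \<open>Lower against upper expectations\<close>

lemma lower_exp_le_upper_exp:
  assumes X: "imprecise_tree X Q" and s: "s \<in> situations X"
  shows "lower_exp X Q f s \<le> upper_exp X Q f s"
proof -
  have "lower_exp X Q f s +\<^sub>e lower_exp X Q (\<lambda>\<omega>. - f \<omega>) s
      \<le> lower_exp X Q (\<lambda>\<omega>. f \<omega> +\<^sub>e - f \<omega>) s"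
    by (rule lower_exp_superadd[OF X])
  also have "\<dots> \<le> lower_exp X Q (\<lambda>_. 0) s"
  proof (rule lower_exp_mono)
    \<comment> \<open>The sum is \<open>0\<close> where \<open>f\<close> is finite and \<open>-\<infinity>\<close> elsewhere.\<close>
    show "f \<omega> +\<^sub>e - f \<omega> \<le> 0" for \<omega> by (cases "f \<omega>") (auto simp: ladd_def)
  qed
  also have "\<dots> = 0" by (rule lower_exp_const[OF X s])
  finally show ?thesis
    unfolding upper_exp_eq_uminus
    by (cases "lower_exp X Q f s"; cases "lower_exp X Q (\<lambda>\<omega>. - f \<omega>) s") (auto simp: ladd_def)
qed

lemma upper_exp_le_SUP:
  assumes X: "imprecise_tree X Q"
  shows "upper_exp X Q f s \<le> (SUP \<omega>\<in>cylinder X s. f \<omega>)"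
  using INF_le_lower_exp[OF X, where f = "\<lambda>\<omega>. - f \<omega>" and s = s]
  by (simp add: upper_exp_eq_uminus ereal_INF_uminus_eq ereal_uminus_le_reorder)

lemma upper_exp_mono_strictly_null:
  assumes X: "imprecise_tree X Q"
    and null: "strictly_null X Q {\<omega> \<in> cylinder X s. f \<omega> > g \<omega>}"
  shows "upper_exp X Q f s \<le> upper_exp X Q g s"
  using lower_exp_mono_strictly_null[OF X, where f = "\<lambda>\<omega>. - g \<omega>" and g = "\<lambda>\<omega>. - f \<omega>"] null
  by (simp add: upper_exp_eq_uminus)

lemma upper_exp_translate:
  assumes X: "imprecise_tree X Q" and s: "s \<in> situations X"
  shows "upper_exp X Q (\<lambda>\<omega>. f \<omega> +\<^sub>e ereal r) s = upper_exp X Q f s +\<^sub>e ereal r"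
proof -
  have neg: "- (a +\<^sub>e ereal r) = - a +\<^sub>e ereal (- r)" "- (a +\<^sub>e ereal (- r)) = - a +\<^sub>e ereal r" for a
    by (cases a; simp add: ladd_def)+
  show ?thesis
    unfolding upper_exp_eq_uminus neg lower_exp_translate[OF X s] ..
qed

theorem proposition14:
  fixes X :: "nat \<Rightarrow> 'a set"
    and Q :: "'a list \<Rightarrow> ('a \<Rightarrow> real) \<Rightarrow> real"
    and s :: "'a list"
    and f g :: "(nat \<Rightarrow> 'a) \<Rightarrow> ereal"
    and c \<mu> :: real
  assumes "imprecise_tree X Q"
    and "s \<in> situations X"
    and "c \<ge> 0"
  shows
    "lower_exp X Q f s \<ge> (INF \<omega>\<in>cylinder X s. f \<omega>) \<and>
     lower_exp X Q (\<lambda>\<omega>. f \<omega> +\<^sub>e g \<omega>) s \<ge> lower_exp X Q f s +\<^sub>e lower_exp X Q g s \<and>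
     lower_exp X Q (\<lambda>\<omega>. ereal c * f \<omega>) s = ereal c * lower_exp X Q f s \<and>
     (strictly_null X Q {\<omega> \<in> cylinder X s. f \<omega> > g \<omega>} \<longrightarrow>
        lower_exp X Q f s \<le> lower_exp X Q g s \<and> upper_exp X Q f s \<le> upper_exp X Q g s) \<and>
     (strictly_null X Q {\<omega> \<in> cylinder X s. f \<omega> \<noteq> g \<omega>} \<longrightarrow>
        lower_exp X Q f s = lower_exp X Q g s \<and> upper_exp X Q f s = upper_exp X Q g s) \<and>
     ((INF \<omega>\<in>cylinder X s. f \<omega>) \<le> lower_exp X Q f s \<and>
      lower_exp X Q f s \<le> upper_exp X Q f s \<and>
      upper_exp X Q f s \<le> (SUP \<omega>\<in>cylinder X s. f \<omega>)) \<and>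
     (lower_exp X Q (\<lambda>\<omega>. f \<omega> +\<^sub>e ereal \<mu>) s = lower_exp X Q f s +\<^sub>e ereal \<mu> \<and>
      upper_exp X Q (\<lambda>\<omega>. f \<omega> +\<^sub>e ereal \<mu>) s = upper_exp X Q f s +\<^sub>e ereal \<mu>)"
proof -
  note X = assms(1) and s = assms(2)
  have eq: "lower_exp X Q f s = lower_exp X Q g s \<and> upper_exp X Q f s = upper_exp X Q g s"
    if null: "strictly_null X Q {\<omega> \<in> cylinder X s. f \<omega> \<noteq> g \<omega>}"
  proof -
    have "strictly_null X Q {\<omega> \<in> cylinder X s. f \<omega> > g \<omega>}"
      "strictly_null X Q {\<omega> \<in> cylinder X s. g \<omega> > f \<omega>}"
      by (rule strictly_null_subset[OF null]; auto)+
    then show ?thesis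
      by (intro conjI antisym lower_exp_mono_strictly_null[OF X]
          upper_exp_mono_strictly_null[OF X])
  qed
  show ?thesis
    by (intro conjI impI INF_le_lower_exp[OF X] lower_exp_superadd[OF X]
        lower_exp_scale[OF X s assms(3)] lower_exp_le_upper_exp[OF X s] upper_exp_le_SUP[OF X]
        lower_exp_translate[OF X s] upper_exp_translate[OF X s]
        lower_exp_mono_strictly_null[OF X] upper_exp_mono_strictly_null[OF X]
        eq[THEN conjunct1] eq[THEN conjunct2])
qed

end
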